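(* Let $f$ be an expansive Lorenz map on $[0,1]$ with critical point $c$, and let $a\in[0,c]$ be fixed. Let $D_f(a)=\{b\in E_f(a):\tau_f(b+)\text{ is periodic}\}$. Then $D_f(a)$ is dense in $E_f(a)$ (with respect to the Euclidean distance).
   Context: **Lorenz maps.** A Lorenz map on $[0,1]$ is a map $f$ with a critical point $c\in(0,1)$ such that $f$ is strictly increasing on $[0,c)$ and on $(c,1]$, $\lim_{x\uparrow c}f(x)=1$ and $\lim_{x\downarrow c}f(x)=0$. It is expansive if $\overline{\bigcup_{n\ge0}f^{-n}(c)}=[0,1]$. **Kneading sequences.** For $x\notin\bigcup_{n\ge0}f^{-n}(c)$, $\tau_f(x)=(\epsilon_0\epsilon_1\dots)\in\{0,1\}^{\mathbb N}$ with $\epsilon_i=0$ if $f^i(x)<c$ and $\epsilon_i=1$ if $f^i(x)>c$. For general $x$, $\tau_f(x+)=\lim_{y\downarrow x}\tau_f(y)$ and $\tau_f(x-)=\lim_{y\uparrow x}\tau_f(y)$, with $y$ not a preimage of $c$. A sequence is periodic if it equals $w^\infty$ for some finite word $w$. **Survivor set and bifurcation set.** A hole is $(a,b)$ with $a\le c\le b$, $a\neq b$. Put $S_f^+(a,b)=\{x\in[0,1]: f(b)\le f^n(x)\le f(a)\ \forall n\ge 0\}$, where one reads $f(a)=1$ if $a=c$ and $f(b)=0$ if $b=c$. For fixed $a$, $E_f(a)=\{b\in[c,1]: S_f^+(a,\epsilon)\ne S_f^+(a,b)\ \text{for all } \epsilon>b\}$; only $b$ with $S_f^+(a,b)$ nonempty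 are considered. **Standing assumptions.** $\mathbf a=\tau_f(a-)$ and $\mathbf b=\tau_f(b+)$ begin with $01$ and $10$ respectively and are self-admissible, where a sequence $\omega$ is self-admissible if $\sigma(\omega)\succeq\sigma^n(\omega)$ for all $n\ge0$ or $\sigma(\omega)\preceq\sigma^n(\omega)$ for all $n\ge0$ ($\sigma$ the left shift, $\preceq$ lexicographic order).
   Formalization: Lorenz maps are taken continuous on [0,c) and (c,1]; density is shown at every b≠c in E_f(a), and at b=c only if τ_f(c+) is periodic or c is a limit point of E_f(a), since the claim can fail when c is isolated in E_f(a) with τ_f(c+) not periodic. *)

theory Defs
  imports "HOL-Analysis.Analysis" "HOL-Library.Fun_Lexorder"
begin

(* The value f c is left arbitrary in [0,1]; only the one-sided limits at c are prescribed.
   Continuity of the two branches is part of the notion of a Lorenz map. *)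
definition lorenz_map :: "(real \<Rightarrow> real) \<Rightarrow> real \<Rightarrow> bool" where
  "lorenz_map f c \<longleftrightarrow>
     0 < c \<and> c < 1 \<and> f ` {0..1} \<subseteq> {0..1} \<and>
     continuous_on {0..<c} f \<and> continuous_on {c<..1} f \<and>
     strict_mono_on {0..<c} f \<and> strict_mono_on {c<..1} f \<and>
     (f \<longlongrightarrow> 1) (at_left c) \<and> (f \<longlongrightarrow> 0) (at_right c)"

definition precritical :: "(real \<Rightarrow> real) \<Rightarrow> real \<Rightarrow> real set" where
  "precritical f c = (\<Union>n. {x \<in> {0..1}. (f ^^ n) x = c})"

definition expansive :: "(real \<Rightarrow> real) \<Rightarrow> real \<Rightarrow> bool" where
  "expansive f c \<longleftrightarrow> closure (precritical f c) = {0..1}"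

(* tau_f(x), meaningful for x in [0,1] that is not precritical. *)
definition itinerary :: "(real \<Rightarrow> real) \<Rightarrow> real \<Rightarrow> real \<Rightarrow> nat \<Rightarrow> nat" where
  "itinerary f c x n = (if (f ^^ n) x < c then 0 else 1)"

(* tau_f(x+) and tau_f(x-).  Limits in the product topology on sequences are taken
   coordinatewise.  The former is meaningful for 0 <= x < 1, the latter for 0 < x <= 1. *)
definition kneading_right :: "(real \<Rightarrow> real) \<Rightarrow> real \<Rightarrow> real \<Rightarrow> nat \<Rightarrow> nat" where
  "kneading_right f c x n =
     Lim (at x within {x<..1} - precritical f c) (\<lambda>y. itinerary f c y n)"

definition kneading_left :: "(real \<Rightarrow> real) \<Rightarrow> real \<Rightarrow> real \<Rightarrow> nat \<Rightarrow> nat" where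
  "kneading_left f c x n =
     Lim (at x within {0..<x} - precritical f c) (\<lambda>y. itinerary f c y n)"

definition shift :: "(nat \<Rightarrow> nat) \<Rightarrow> nat \<Rightarrow> nat" where
  "shift \<omega> = (\<lambda>i. \<omega> (Suc i))"

definition lex_le :: "(nat \<Rightarrow> nat) \<Rightarrow> (nat \<Rightarrow> nat) \<Rightarrow> bool" where
  "lex_le \<omega> \<eta> \<longleftrightarrow> less_fun \<omega> \<eta> \<or> \<omega> = \<eta>"

definition periodic_seq :: "(nat \<Rightarrow> nat) \<Rightarrow> bool" where
  "periodic_seq \<omega> \<longleftrightarrow> (\<exists>w. w \<noteq> [] \<and> (\<forall>i. \<omega> i = w ! (i mod length w)))"

definition self_admissible :: "(nat \<Rightarrow> nat) \<Rightarrow> bool" where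
  "self_admissible \<omega> \<longleftrightarrow>
     (\<forall>n. lex_le ((shift ^^ n) \<omega>) (shift \<omega>)) \<or> (\<forall>n. lex_le (shift \<omega>) ((shift ^^ n) \<omega>))"

(* The standing assumptions on the end points of a hole, including the existence of the
   one-sided limits defining tau_f(a-) and tau_f(b+). *)
definition admissible_left :: "(real \<Rightarrow> real) \<Rightarrow> real \<Rightarrow> real \<Rightarrow> bool" where
  "admissible_left f c a \<longleftrightarrow> 0 < a \<and> a \<le> c \<and>
     kneading_left f c a 0 = 0 \<and> kneading_left f c a 1 = 1 \<and>
     self_admissible (kneading_left f c a)"

definition admissible_right :: "(real \<Rightarrow> real) \<Rightarrow> real \<Rightarrow> real \<Rightarrow> bool" where
  "admissible_right f c b \<longleftrightarrow> c \<le> b \<and> b < 1 \<and>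
     kneading_right f c b 0 = 1 \<and> kneading_right f c b 1 = 0 \<and>
     self_admissible (kneading_right f c b)"

definition survivor_plus :: "(real \<Rightarrow> real) \<Rightarrow> real \<Rightarrow> real \<Rightarrow> real \<Rightarrow> real set" where
  "survivor_plus f c a b =
     {x \<in> {0..1}. \<forall>n. (if b = c then 0 else f b) \<le> (f ^^ n) x \<and>
                      (f ^^ n) x \<le> (if a = c then 1 else f a)}"

definition E_set :: "(real \<Rightarrow> real) \<Rightarrow> real \<Rightarrow> real \<Rightarrow> real set" where
  "E_set f c a =
     {b \<in> {c..1}. admissible_right f c b \<and> survivor_plus f c a b \<noteq> {} \<and>
        (\<forall>\<epsilon>\<in>{b<..1}. survivor_plus f c a \<epsilon> \<noteq> survivor_plus f c a b)}"

(* D_set need not be dense at the end point c of E_set: for f x = beta x + 2 - beta mod 1, f 1 = 1,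
   with beta^3 = beta^2 + 2 beta - 1, beta = 1.80..., and a = f 0, one has E_set = {c, f a} and
   D_set = {f a}, since tau_f(c+) = 10(01)^infinity is not periodic. *)
definition D_set :: "(real \<Rightarrow> real) \<Rightarrow> real \<Rightarrow> real \<Rightarrow> real set" where
  "D_set f c a = {b \<in> E_set f c a. periodic_seq (kneading_right f c b)}"

end

theory Submission
  imports Defs
begin

text \<open>
  Let \<open>b > c\<close> be in \<open>E_set f c a\<close> and put \<open>x = f b\<close>.  Since \<open>\<tau>(b+)\<close> begins with \<open>10\<close>,
  self-admissibility means that \<open>x\<close> is the least point of its orbit.  Hence \<open>b\<close> is not precritical
  (a branch that hits \<open>c\<close> continues from the right at \<open>0 < x\<close>), and the condition defining
  \<open>E_set\<close> forces the orbit of \<open>x\<close> to stay below \<open>f a\<close>.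
  By expansiveness there is, just to the left of \<open>x\<close>, a point \<open>z\<close> that hits \<open>c\<close> at a minimal
  time \<open>m\<close>.  The map \<open>f^(m+1)\<close> is continuous and increasing on \<open>(z, x]\<close>, tends to \<open>0\<close> at \<open>z\<close>, and
  maps \<open>x\<close> to a point at or above \<open>x\<close>, so it has a fixed point in \<open>(z, x]\<close>.  Among all periodic
  points in \<open>(z, x]\<close>, one \<open>q\<close> of minimal period is the least point of its orbit, and by monotonicity
  its orbit lies below that of \<open>x\<close>.  The preimage of \<open>q\<close> in \<open>(c, b]\<close> is then periodic itself
  and lies in \<open>D_set f c a\<close>.
\<close>

section \<open>Shifts and the lexicographic order\<close>

lemma shift_funpow: "(shift ^^ n) \<omega> = (\<lambda>i. \<omega> (n + i))"
  by (induction n) (auto simp: shift_def fun_eq_iff)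

lemma not_less_fun_lex_le:
  fixes g h :: "nat \<Rightarrow> nat"
  assumes "less_fun g h" "lex_le h g"
  shows False
  using assms less_fun_asym[of g h] less_fun_irrefl[of g] unfolding lex_le_def by metis

locale lorenz =
  fixes f :: "real \<Rightarrow> real" and c :: real
  assumes lorenz: "lorenz_map f c" and expansive: "expansive f c"
begin

section \<open>Branches of the map and precritical points\<close>

lemma c_pos: "0 < c" and c_less_1: "c < 1"
  and cont_left: "continuous_on {0..<c} f" and cont_right: "continuous_on {c<..1} f"
  and mono_left: "strict_mono_on {0..<c} f" and mono_right: "strict_mono_on {c<..1} f"
  and lim_right: "(f \<longlongrightarrow> 0) (at_right c)"
  using lorenz unfolding lorenz_map_def by auto

lemma f_in: "x \<in> {0..1} \<Longrightarrow> f x \<in> {0..1}"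
  using lorenz unfolding lorenz_map_def by blast

lemma funpow_in: "x \<in> {0..1} \<Longrightarrow> (f ^^ n) x \<in> {0..1}"
  by (induction n) (use f_in in auto)

lemma f_less: "\<lbrakk>x < y; 0 \<le> x; y \<le> 1; y < c \<or> c < x\<rbrakk> \<Longrightarrow> f x < f y"
  using strict_mono_onD[OF mono_left, of x y] strict_mono_onD[OF mono_right, of x y] by auto

lemma f_le: "\<lbrakk>x \<le> y; 0 \<le> x; y \<le> 1; y < c \<or> c < x\<rbrakk> \<Longrightarrow> f x \<le> f y"
  using f_less[of x y] by (cases "x = y") auto

text \<open>The midpoint of \<open>c\<close> and \<open>x\<close> has a nonnegative image strictly
  below \<open>f x\<close>; the value \<open>f c\<close> is arbitrary and offers no such
  bound.\<close>

lemma f_pos: assumes "c < x" "x \<le> 1" shows "0 < f x"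
proof -
  have "0 \<le> f ((c + x) / 2)"
    using f_in[of "(c + x) / 2"] assms c_pos by auto
  also have "\<dots> < f x"
    using assms c_pos by (intro f_less) auto
  finally show ?thesis .
qed

lemma f_less_1: assumes "0 \<le> x" "x < 1" "x \<noteq> c" shows "f x < 1"
proof (cases "x < c")
  case True
  have "f x < f ((x + c) / 2)"
    using assms c_less_1 True by (intro f_less) auto
  also have "\<dots> \<le> 1"
    using f_in[of "(x + c) / 2"] assms c_less_1 True by auto
  finally show ?thesis .
next
  case False
  have "f x < f 1"
    using assms False by (intro f_less) auto
  also have "\<dots> \<le> 1"
    using f_in[of 1] by auto
  finally show ?thesis .
qed

lemma not_precritical_funpow:
  assumes "x \<in> {0..1}" "x \<notin> precritical f c"
  shows "(f ^^ n) x \<noteq> c" "(f ^^ n) x \<notin> precritical f c"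
proof -
  have no_hit: "(f ^^ k) x \<noteq> c" for k
    using assms by (auto simp: precritical_def)
  show "(f ^^ n) x \<noteq> c"
    by (rule no_hit)
  have "(f ^^ k) ((f ^^ n) x) \<noteq> c" for k
    using no_hit[of "k + n"] by (simp add: funpow_add)
  then show "(f ^^ n) x \<notin> precritical f c"
    by (auto simp: precritical_def)
qed

lemma precritical_dense:
  assumes "0 \<le> u" "u < v" "v \<le> 1"
  shows "\<exists>z\<in>{u<..<v}. \<exists>n. (f ^^ n) z = c"
proof -
  have "(u + v) / 2 \<in> closure (precritical f c)"
    using expansive assms unfolding expansive_def by auto
  then have "{u<..<v} \<inter> precritical f c \<noteq> {}"
    using assms open_Int_closure_eq_empty[of "{u<..<v}" "precritical f c"]
      IntI[of "(u + v) / 2" "{u<..<v}"] by (auto simp: set_eq_iff)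
  then show ?thesis
    by (auto simp: precritical_def)
qed

text \<open>Each level of preimages maps into the previous one, injectively on either branch, with
  only \<open>c\<close> left over. Hence the points over which kneading limits are taken accumulate
  everywhere.\<close>

lemma countable_precritical: "countable (precritical f c)"
proof -
  have "countable {x \<in> {0..1}. (f ^^ n) x = c}" for n
  proof (induction n)
    case 0
    then show ?case by (rule countable_subset[of _ "{c}"]) auto
  next
    case (Suc n)
    let ?P = "{x \<in> {0..1}. (f ^^ n) x = c}"
    have inj: "inj_on f {0..<c}" "inj_on f {c<..1}"
      using mono_left mono_right by (auto intro: strict_mono_on_imp_inj_on)
    have pre: "countable (f -` ?P \<inter> J)" if "inj_on f J" for J
    proof (rule countable_image_inj_on)
      show "countable (f ` (f -` ?P \<inter> J))"
        by (rule countable_subset[OF _ Suc]) blast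
      show "inj_on f (f -` ?P \<inter> J)"
        by (rule inj_on_subset[OF that]) blast
    qed
    then have "countable ((f -` ?P \<inter> {0..<c}) \<union> (f -` ?P \<inter> {c<..1}) \<union> {c})"
      using pre[OF inj(1)] pre[OF inj(2)] by simp
    moreover have "{x \<in> {0..1}. (f ^^ Suc n) x = c} \<subseteq> (f -` ?P \<inter> {0..<c}) \<union> (f -` ?P \<inter> {c<..1}) \<union> {c}"
    proof
      fix x assume x: "x \<in> {x \<in> {0..1}. (f ^^ Suc n) x = c}"
      then have "f x \<in> ?P"
        using f_in by (auto simp: funpow_swap1)
      then show "x \<in> (f -` ?P \<inter> {0..<c}) \<union> (f -` ?P \<inter> {c<..1}) \<union> {c}"
        using x by auto
    qed
    ultimately show ?case
      by (rule countable_subset[rotated])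
  qed
  then show ?thesis
    unfolding precritical_def by (intro countable_UN) auto
qed

section \<open>Iterates on intervals that avoid the critical point\<close>

lemma one_sided:
  assumes "connected J" "J \<subseteq> {0..1}" "c \<notin> J"
  shows "J \<subseteq> {0..<c} \<or> J \<subseteq> {c<..1}"
proof (rule ccontr)
  assume "\<not> ?thesis"
  then obtain p q where pq: "p \<in> J" "\<not> p < c" "q \<in> J" "\<not> c < q"
    using assms(2) by fastforce
  then have "c \<in> J"
    using assms(1) unfolding connected_iff_interval by (metis linorder_not_less)
  then show False using assms by simp
qed

text \<open>Inductively \<open>f ^^ n\<close> maps \<open>I\<close> onto a connected set missing
  \<open>c\<close>, hence into a single branch, where \<open>f\<close> is continuous and
  increasing.\<close>

lemma funpow_continuous_strict_mono:
  assumes "connected I" "I \<subseteq> {0..1}" "\<And>i y. i < n \<Longrightarrow> y \<in> I \<Longrightarrow> (f ^^ i) y \<noteq> c"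
  shows "continuous_on I (f ^^ n) \<and> strict_mono_on I (f ^^ n)"
  using assms(3)
proof (induction n)
  case 0
  then show ?case by (auto simp: strict_mono_on_def)
next
  case (Suc n)
  then have IH: "continuous_on I (f ^^ n)" "strict_mono_on I (f ^^ n)" by auto
  let ?J = "(f ^^ n) ` I"
  have "connected ?J" using IH assms(1) by (intro connected_continuous_image)
  moreover have "?J \<subseteq> {0..1}" using funpow_in assms(2) by blast
  moreover have "c \<notin> ?J" using Suc.prems[of n] by auto
  ultimately have "?J \<subseteq> {0..<c} \<or> ?J \<subseteq> {c<..1}" by (rule one_sided)
  then have J: "continuous_on ?J f" "strict_mono_on ?J f"
    using cont_left cont_right mono_left mono_right
    by (auto intro: continuous_on_subset simp: strict_mono_on_def subset_iff)
  have "continuous_on I (f \<circ> (f ^^ n))"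
    using IH J by (intro continuous_on_compose)
  moreover have "strict_mono_on I (f \<circ> (f ^^ n))"
    using IH J unfolding strict_mono_on_def by auto
  ultimately show ?case by (simp only: funpow.simps simp_thms)
qed

lemma itinerary_constant:
  assumes "connected I" "I \<subseteq> {0..1}" "\<And>i y. i < n \<Longrightarrow> y \<in> I \<Longrightarrow> (f ^^ i) y \<noteq> c"
    and "x \<in> I" "y \<in> I" "i < n"
  shows "itinerary f c x i = itinerary f c y i"
proof -
  have "continuous_on I (f ^^ i)"
    using assms by (intro funpow_continuous_strict_mono[THEN conjunct1]) auto
  then have "connected ((f ^^ i) ` I)"
    using assms(1) by (intro connected_continuous_image)
  moreover have "(f ^^ i) ` I \<subseteq> {0..1}" using funpow_in assms(2) by blast
  moreover have "c \<notin> (f ^^ i) ` I" using assms(3,6) by auto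
  ultimately have "(f ^^ i) ` I \<subseteq> {0..<c} \<or> (f ^^ i) ` I \<subseteq> {c<..1}" by (rule one_sided)
  then show ?thesis
    using assms(4,5) by (force simp: itinerary_def)
qed

text \<open>While no earlier iterate hits \<open>c\<close>, \<open>f ^^ n\<close> is injective on
  the interval and hits \<open>c\<close> at most once; cutting the interval there removes the
  hit.\<close>

lemma no_hit_right:
  assumes "0 \<le> v" "v < 1"
  shows "\<exists>w>v. w \<le> 1 \<and> (\<forall>i<n. \<forall>y\<in>{v<..<w}. (f ^^ i) y \<noteq> c)"
proof (induction n)
  case 0
  then show ?case using assms by auto
next
  case (Suc n)
  then obtain w where w: "v < w" "w \<le> 1" "\<forall>i<n. \<forall>y\<in>{v<..<w}. (f ^^ i) y \<noteq> c" by auto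
  have mono: "strict_mono_on {v<..<w} (f ^^ n)"
    using w assms by (intro funpow_continuous_strict_mono[THEN conjunct2]) auto
  show ?case
  proof (cases "\<exists>z\<in>{v<..<w}. (f ^^ n) z = c")
    case True
    then obtain z where z: "z \<in> {v<..<w}" "(f ^^ n) z = c" by auto
    have "(f ^^ i) y \<noteq> c" if "i < Suc n" "y \<in> {v<..<z}" for i y
      using that w(3) z strict_mono_onD[OF mono, of y z] by (cases "i = n") auto
    then show ?thesis
      using z w by (intro exI[of _ z]) auto
  next
    case False
    then show ?thesis
      using w by (intro exI[of _ w]) (auto simp: less_Suc_eq)
  qed
qed

section \<open>Kneading sequences and itineraries\<close>

lemma kneading_right_eqI:
  assumes "0 \<le> x" "x < w" "w \<le> 1" "\<And>y. y \<in> {x<..<w} \<Longrightarrow> itinerary f c y n = v"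
  shows "kneading_right f c x n = v"
proof -
  let ?S = "{x<..1} - precritical f c"
  \<comment> \<open>\<open>Lim\<close> is determined only for a nontrivial filter, so
    non-precritical points must accumulate at \<open>x\<close> from the right; a countable set
    cannot exhaust an interval.\<close>
  have "x islimpt ?S"
    unfolding islimpt_approachable
  proof (intro allI impI)
    fix e :: real assume "0 < e"
    then have "uncountable ({x<..<min 1 (x + e)} - precritical f c)"
      using assms countable_precritical
      by (intro uncountable_minus_countable) (auto simp: uncountable_open_interval)
    then obtain y where "y \<in> {x<..<min 1 (x + e)} - precritical f c"
      by (metis countable_empty ex_in_conv)
    then show "\<exists>x'\<in>?S. x' \<noteq> x \<and> dist x' x < e"
      by (intro bexI[of _ y]) (auto simp: dist_real_def)
  qed
  moreover have "\<forall>\<^sub>F y in at x within ?S. itinerary f c y n = v"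
    unfolding eventually_at
    using assms by (intro exI[of _ "w - x"]) (auto simp: dist_real_def)
  ultimately show ?thesis
    unfolding kneading_right_def
    by (intro tendsto_Lim tendsto_eventually) (auto simp: trivial_limit_within)
qed

lemma kneading_right_near:
  assumes "0 \<le> x" "x < 1"
  shows "\<exists>w>x. w \<le> 1 \<and> (\<forall>y\<in>{x<..<w}. \<forall>i<n. kneading_right f c x i = itinerary f c y i)"
proof -
  obtain w where w: "w > x" "w \<le> 1" "\<forall>i<n. \<forall>y\<in>{x<..<w}. (f ^^ i) y \<noteq> c"
    using no_hit_right[OF assms] by blast
  have "kneading_right f c x i = itinerary f c y i" if "y \<in> {x<..<w}" "i < n" for y i
  proof (rule kneading_right_eqI[of _ w])
    fix z assume "z \<in> {x<..<w}"
    then show "itinerary f c z i = itinerary f c y i"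
      using w that assms by (intro itinerary_constant[of "{x<..<w}" n]) auto
  qed (use w assms in auto)
  then show ?thesis using w by blast
qed

lemma kneading_right_eq_itinerary:
  assumes "0 \<le> x" "x < 1" "x \<notin> precritical f c"
  shows "kneading_right f c x = itinerary f c x"
proof
  fix n
  obtain w where w: "w > x" "w \<le> 1" "\<forall>i<Suc n. \<forall>y\<in>{x<..<w}. (f ^^ i) y \<noteq> c"
    using no_hit_right[OF assms(1,2)] by blast
  have nh: "(f ^^ i) y \<noteq> c" if "i < Suc n" "y \<in> {x..<w}" for i y
    using that w assms not_precritical_funpow[of x i] by (cases "x = y") auto
  show "kneading_right f c x n = itinerary f c x n"
  proof (rule kneading_right_eqI[of _ w])
    fix z assume "z \<in> {x<..<w}"
    then show "itinerary f c z n = itinerary f c x n"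
      using w assms nh by (intro itinerary_constant[of "{x..<w}" "Suc n"]) auto
  qed (use w assms in auto)
qed

lemma itinerary_funpow: "itinerary f c ((f ^^ n) x) i = itinerary f c x (n + i)"
proof -
  have "(f ^^ (n + i)) x = (f ^^ i) ((f ^^ n) x)"
    by (simp only: add.commute[of n i] funpow_add comp_apply)
  then show ?thesis
    by (simp only: itinerary_def)
qed

text \<open>While the digits agree, both orbits run through the same branch and keep their order; at
  the first disagreement this leaves only 0 against 1.\<close>

lemma itinerary_mono:
  assumes "x \<in> {0..1}" "x \<notin> precritical f c" "y \<in> {0..1}" "y \<notin> precritical f c" "x \<le> y"
  shows "lex_le (itinerary f c x) (itinerary f c y)"
proof (cases "itinerary f c x = itinerary f c y")
  case False
  define k where "k = (LEAST k. itinerary f c x k \<noteq> itinerary f c y k)"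
  have "\<exists>k. itinerary f c x k \<noteq> itinerary f c y k"
    using False by (simp add: fun_eq_iff)
  then have k: "itinerary f c x k \<noteq> itinerary f c y k"
    unfolding k_def by (rule LeastI_ex)
  have below: "itinerary f c x i = itinerary f c y i" if "i < k" for i
    using not_less_Least[of i "\<lambda>k. itinerary f c x k \<noteq> itinerary f c y k"] that
    unfolding k_def by auto
  have "i \<le> k \<Longrightarrow> (f ^^ i) x \<le> (f ^^ i) y" for i
  proof (induction i)
    case (Suc i)
    \<comment> \<open>The digit is 1 also at \<open>c\<close> itself, so
      \<open>c < (f ^^ i) x\<close> relies on \<open>x\<close> not being precritical.\<close>
    have "(f ^^ i) y < c \<or> c < (f ^^ i) x"
      using below[of i] Suc.prems not_precritical_funpow(1)[OF assms(1,2), of i]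
      by (auto simp: itinerary_def split: if_splits)
    then show ?case
      using Suc funpow_in[OF assms(1), of i] funpow_in[OF assms(3), of i]
      by (auto intro: f_le)
  qed (use assms in auto)
  from this[of k] have "itinerary f c x k < itinerary f c y k"
    using k by (auto simp: itinerary_def split: if_splits)
  then show ?thesis
    unfolding lex_le_def less_fun_def using below by blast
qed (auto simp: lex_le_def)

section \<open>One-sided limits of iterates\<close>

lemma filterlim_f_at_right:
  assumes "0 \<le> x" "x < 1" "x \<noteq> c"
  shows "filterlim f (at_right (f x)) (at_right x)"
proof -
  define d where "d = (if x < c then (x + c) / 2 else 1)"
  have d: "x < d" "d \<le> 1" "d < c \<or> c < x"
    using assms c_less_1 by (auto simp: d_def)
  have "continuous_on {x..d} f"
    using d assms cont_left cont_right
    by (auto simp: d_def intro: continuous_on_subset split: if_splits)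
  then have "(f \<longlongrightarrow> f x) (at x within {x..d})"
    using d by (auto simp: continuous_on_def)
  then have "(f \<longlongrightarrow> f x) (at_right x)"
    using d by (simp add: at_within_Icc_at_right)
  \<comment> \<open>Strict approach from above is what lets these limits be composed along an
    orbit.\<close>
  moreover have "\<forall>\<^sub>F y in at_right x. f y \<in> {f x<..}"
    using eventually_at_right_real[OF d(1)]
    by eventually_elim (use d assms in \<open>auto intro!: f_less\<close>)
  ultimately show ?thesis
    unfolding filterlim_at by (auto elim: eventually_mono)
qed

lemma filterlim_f_at_right_c: "filterlim f (at_right 0) (at_right c)"
proof -
  have "\<forall>\<^sub>F y in at_right c. f y \<in> {0<..}"
    using eventually_at_right_real[OF c_less_1]
    by eventually_elim (auto intro!: f_pos)
  then show ?thesis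
    using lim_right unfolding filterlim_at by (auto elim: eventually_mono)
qed

lemma filterlim_funpow_at_right:
  assumes "0 \<le> x" "x < 1" "\<And>i. i < n \<Longrightarrow> (f ^^ i) x \<noteq> c"
  shows "(f ^^ n) x < 1 \<and> filterlim (f ^^ n) (at_right ((f ^^ n) x)) (at_right x)"
  using assms(3)
proof (induction n)
  case 0
  then show ?case using assms(2) by (simp add: filterlim_def id_def)
next
  case (Suc n)
  then have IH: "(f ^^ n) x < 1" "filterlim (f ^^ n) (at_right ((f ^^ n) x)) (at_right x)"
    by auto
  have n: "0 \<le> (f ^^ n) x" "(f ^^ n) x \<noteq> c"
    using funpow_in[of x n] assms Suc.prems[of n] by auto
  have "filterlim (\<lambda>y. f ((f ^^ n) y)) (at_right (f ((f ^^ n) x))) (at_right x)"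
    using filterlim_compose[OF filterlim_f_at_right IH(2)] n IH by auto
  then show ?case
    using f_less_1[of "(f ^^ n) x"] n IH by (simp add: o_def)
qed

section \<open>Consequences of self-admissibility\<close>

lemma admissible_right_shift_le:
  assumes "admissible_right f c b"
  shows "lex_le (shift (kneading_right f c b)) ((shift ^^ n) (kneading_right f c b))"
proof -
  let ?k = "kneading_right f c b"
  have k: "?k 0 = 1" "?k (Suc 0) = 0"
    using assms by (auto simp: admissible_right_def)
  \<comment> \<open>A sequence beginning with \<open>10\<close> exceeds its shift, so
    \<open>n = 0\<close> rules out the alternative in which the shift is the largest.\<close>
  then have "less_fun (shift ?k) ?k"
    unfolding less_fun_def by (intro exI[of _ 0]) (auto simp: shift_def)
  then have "\<not> lex_le ?k (shift ?k)"
    using not_less_fun_lex_le by blast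
  then have "\<not> (\<forall>n. lex_le ((shift ^^ n) ?k) (shift ?k))"
    by (metis funpow_0)
  then show ?thesis
    using assms by (auto simp: admissible_right_def self_admissible_def)
qed

text \<open>
  The limit \<open>u\<close> need not be \<open>(f ^^ n) b\<close>: if the orbit of \<open>b\<close> hits \<open>c\<close>, it continues from
  the right at \<open>0\<close>, whereas \<open>f c\<close> is arbitrary.
\<close>
lemma right_orbit_ge:
  assumes adm: "admissible_right f c b" and "c < b" and u: "0 \<le> u"
    and lim: "filterlim (f ^^ n) (at_right u) (at_right b)"
  shows "f b \<le> u"
proof (rule ccontr)
  assume "\<not> f b \<le> u"
  define v where "v = f b"
  have b: "0 \<le> b" "b < 1" "b \<noteq> c"
    using assms c_pos by (auto simp: admissible_right_def)
  have v: "u < v" "v < 1"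
    using \<open>\<not> f b \<le> u\<close> f_less_1 b by (auto simp: v_def)
  \<comment> \<open>By minimality of \<open>m\<close>, \<open>f ^^ m\<close> will be increasing on
    \<open>(u, w)\<close> for some \<open>w > v\<close>, so a hit \<open>z\<close> separates points
    near \<open>u\<close> from points just above \<open>v\<close>.\<close>
  define m where "m = (LEAST m. \<exists>z\<in>{u<..v}. (f ^^ m) z = c)"
  have "\<exists>m. \<exists>z\<in>{u<..v}. (f ^^ m) z = c"
    using precritical_dense[of u v] v u by force
  then have "\<exists>z\<in>{u<..v}. (f ^^ m) z = c"
    unfolding m_def by (rule LeastI_ex)
  then obtain z where z: "u < z" "z \<le> v" "(f ^^ m) z = c" by auto
  have nh: "(f ^^ i) y \<noteq> c" if "i < m" "y \<in> {u<..v}" for i y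
    using not_less_Least[of i "\<lambda>m. \<exists>z\<in>{u<..v}. (f ^^ m) z = c"] that
    unfolding m_def by auto
  obtain w where w: "w > v" "w \<le> 1" "\<forall>i<m. \<forall>y\<in>{v<..<w}. (f ^^ i) y \<noteq> c"
    using no_hit_right[of v m] v u by auto
  have nh': "(f ^^ i) y \<noteq> c" if "i < m" "y \<in> {u<..<w}" for i y
    using nh w that by (cases "y \<le> v") auto
  have mono: "strict_mono_on {u<..<w} (f ^^ m)"
    using nh' w u by (intro funpow_continuous_strict_mono[THEN conjunct2]) auto
  \<comment> \<open>The digits compared are those at \<open>Suc i\<close> and \<open>n + i\<close>
    for \<open>i \<le> m\<close>, all at indices below \<open>Suc (Suc (n + m))\<close>.\<close>
  obtain w' where w': "w' > b" "w' \<le> 1"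
      "\<forall>y\<in>{b<..<w'}. \<forall>i<Suc (Suc (n + m)). kneading_right f c b i = itinerary f c y i"
    using kneading_right_near[of b] b by blast
  have "\<forall>\<^sub>F y in at_right b. y \<in> {b<..<w'}"
    using w' by (intro eventually_at_right_real)
  moreover have "\<forall>\<^sub>F y in at_right b. f y \<in> {v<..<w}"
    using filterlim_f_at_right[OF b] eventually_at_right_real[OF w(1)]
    unfolding filterlim_iff v_def by blast
  moreover have "\<forall>\<^sub>F y in at_right b. (f ^^ n) y \<in> {u<..<z}"
    using lim eventually_at_right_real[OF z(1)]
    unfolding filterlim_iff by blast
  ultimately have "\<forall>\<^sub>F y in at_right b. y \<in> {b<..<w'} \<and> f y \<in> {v<..<w} \<and> (f ^^ n) y \<in> {u<..<z}"
    by eventually_elim auto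
  then obtain y where y: "y \<in> {b<..<w'}" "f y \<in> {v<..<w}" "(f ^^ n) y \<in> {u<..<z}"
    using eventually_happens'[OF trivial_limit_at_right_real] by blast
  let ?k = "kneading_right f c b"
  have k: "?k (Suc i) = itinerary f c (f y) i" "?k (n + i) = itinerary f c ((f ^^ n) y) i"
    if "i \<le> m" for i
    using w'(3) y(1) that itinerary_funpow[of 1 y i] by (auto simp: itinerary_funpow)
  have "?k (n + i) = ?k (Suc i)" if "i < m" for i
  proof -
    have "itinerary f c ((f ^^ n) y) i = itinerary f c (f y) i"
      by (rule itinerary_constant[of "{u<..<w}" m]) (use that y z v w u nh' in auto)
    then show ?thesis
      using that k[of i] by simp
  qed
  \<comment> \<open>Since \<open>(f ^^ n) y < z < f y\<close>, \<open>f ^^ m\<close> sends these two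
    points to opposite sides of \<open>c\<close>.\<close>
  moreover have "?k (n + m) < ?k (Suc m)"
    using strict_mono_onD[OF mono, of "(f ^^ n) y" z] strict_mono_onD[OF mono, of z "f y"]
      y z w k[of m]
    by (auto simp: itinerary_def)
  ultimately have "less_fun ((shift ^^ n) ?k) (shift ?k)"
    unfolding less_fun_def shift_funpow by (intro exI[of _ m]) (auto simp: shift_def)
  then show False
    using not_less_fun_lex_le admissible_right_shift_le[OF adm, of n] by blast
qed

text \<open>At a first hit, orbits from the right of \<open>b\<close> arrive at \<open>c\<close>
  from the right and continue near 0, so the lower bound on right limits would force
  \<open>f b \<le> 0\<close>.\<close>

lemma admissible_right_not_precritical:
  assumes "admissible_right f c b" "c < b"
  shows "b \<notin> precritical f c"
proof
  assume "b \<in> precritical f c"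
  then have ex: "\<exists>n. (f ^^ n) b = c" by (auto simp: precritical_def)
  define n where "n = (LEAST n. (f ^^ n) b = c)"
  have n: "(f ^^ n) b = c"
    unfolding n_def using ex by (rule LeastI_ex)
  have nh: "(f ^^ i) b \<noteq> c" if "i < n" for i
    using not_less_Least that unfolding n_def by blast
  have b: "0 \<le> b" "b < 1"
    using assms c_pos by (auto simp: admissible_right_def)
  have "filterlim (f ^^ n) (at_right c) (at_right b)"
    using filterlim_funpow_at_right[OF b nh] n by auto
  then have "filterlim (f ^^ Suc n) (at_right 0) (at_right b)"
    using filterlim_compose[OF filterlim_f_at_right_c] by (auto simp: o_def)
  then have "f b \<le> 0"
    using right_orbit_ge[of b 0 "Suc n"] assms by auto
  then show False
    using f_pos[of b] assms b by auto
qed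

lemma admissible_right_orbit_ge:
  assumes "admissible_right f c b" "c < b"
  shows "f b \<le> (f ^^ n) b"
proof -
  have b: "0 \<le> b" "b < 1"
    using assms c_pos by (auto simp: admissible_right_def)
  have "filterlim (f ^^ n) (at_right ((f ^^ n) b)) (at_right b)"
    using filterlim_funpow_at_right[OF b] not_precritical_funpow(1)[of b]
      admissible_right_not_precritical[OF assms] b by auto
  then show ?thesis
    using right_orbit_ge[OF assms, of "(f ^^ n) b" n] funpow_in[of b n] b by auto
qed

section \<open>Periodic points\<close>

text \<open>By monotonicity \<open>p\<close> would trap every orbit starting in
  \<open>(0, p)\<close> to the left of \<open>c\<close>, against the density of precritical
  points.\<close>

lemma no_fixed_point_left:
  assumes "0 < p" "p < c" shows "f p \<noteq> p"
proof
  assume p: "f p = p"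
  obtain y n where y: "0 < y" "y < p" "(f ^^ n) y = c"
    using precritical_dense[of 0 p] assms c_less_1 by force
  have "0 \<le> (f ^^ i) y \<and> (f ^^ i) y \<le> p" for i
  proof (induction i)
    case (Suc i)
    then show ?case
      using f_le[of "(f ^^ i) y" p] f_in[of "(f ^^ i) y"] assms p c_less_1 by auto
  qed (use y in auto)
  from this[of n] show False
    using y assms by auto
qed

lemma funpow_fixed_point_between:
  assumes "p \<le> x" "{p..x} \<subseteq> {0..1}" "\<And>i y. i < n \<Longrightarrow> y \<in> {p..x} \<Longrightarrow> (f ^^ i) y \<noteq> c"
    and "(f ^^ n) p \<le> p" "x \<le> (f ^^ n) x"
  shows "\<exists>q\<in>{p..x}. (f ^^ n) q = q"
proof -
  have "continuous_on {p..x} (f ^^ n)"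
    using assms by (intro funpow_continuous_strict_mono[THEN conjunct1]) auto
  then have "continuous_on {p..x} (\<lambda>y. (f ^^ n) y - y)"
    by (intro continuous_intros)
  then show ?thesis
    using IVT'[of "\<lambda>y. (f ^^ n) y - y" p 0 x] assms by auto
qed

text \<open>The parameter \<open>l\<close> makes \<open>q\<close> as close to \<open>x\<close> as
  desired. Comparing the orbits over one period suffices to pass upper bounds from the orbit of
  \<open>x\<close> to that of \<open>q\<close>.\<close>

lemma exists_minimal_periodic_point:
  assumes "0 \<le> l" "l < x" "x \<le> 1" "x \<notin> precritical f c" "\<And>n. x \<le> (f ^^ n) x"
  shows "\<exists>q j. l < q \<and> q \<le> x \<and> 0 < j \<and> (f ^^ j) q = q \<and> (\<forall>n. q \<le> (f ^^ n) q) \<and>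
    (\<forall>i<j. (f ^^ i) q \<le> (f ^^ i) x) \<and> (\<forall>n. (f ^^ n) q \<noteq> c)"
proof -
  have x: "x \<in> {0..1}" using assms by auto
  define m where "m = (LEAST m. \<exists>z\<in>{l<..<x}. (f ^^ m) z = c)"
  have "\<exists>m. \<exists>z\<in>{l<..<x}. (f ^^ m) z = c"
    using precritical_dense[of l x] assms(1-3) by blast
  then have "\<exists>z\<in>{l<..<x}. (f ^^ m) z = c"
    unfolding m_def by (rule LeastI_ex)
  then obtain z where z: "l < z" "z < x" "(f ^^ m) z = c" by auto
  have nh: "(f ^^ i) y \<noteq> c" if "i < m" "y \<in> {l<..x}" for i y
    using not_less_Least[of i "\<lambda>m. \<exists>z\<in>{l<..<x}. (f ^^ m) z = c"] that
      not_precritical_funpow(1)[OF x assms(4), of i]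
    unfolding m_def by (cases "y = x") auto
  have mono: "strict_mono_on {l<..x} (f ^^ m)"
    using nh assms(1,3) by (intro funpow_continuous_strict_mono[THEN conjunct2]) auto
  \<comment> \<open>To the right of \<open>z\<close> the iterate at time \<open>m\<close> exceeds
    \<open>c\<close>, so one more iteration stays continuous.\<close>
  have nh': "(f ^^ i) y \<noteq> c" if "i < Suc m" "y \<in> {z<..x}" for i y
    using nh[of i y] that z strict_mono_onD[OF mono, of z y] by (cases "i = m") auto
  have lim: "filterlim (f ^^ Suc m) (at_right 0) (at_right z)"
  proof -
    have "filterlim (f ^^ m) (at_right c) (at_right z)"
      using filterlim_funpow_at_right[of z m] nh z assms(1,3) by auto
    then show ?thesis
      using filterlim_compose[OF filterlim_f_at_right_c] by (auto simp: o_def)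
  qed
  let ?P = "\<lambda>j. 0 < j \<and> (\<exists>q\<in>{z<..x}. (f ^^ j) q = q)"
  have P: "?P (Suc m)"
  proof -
    \<comment> \<open>At \<open>z\<close> itself \<open>f ^^ Suc m\<close> takes the arbitrary value
      \<open>f c\<close>, so the fixed point argument starts at a point just right of
      \<open>z\<close> whose image is below \<open>z\<close>.\<close>
    have "\<forall>\<^sub>F y in at_right z. (f ^^ Suc m) y \<in> {0<..<z}"
      using lim eventually_at_right_real[of 0 z] z assms(1)
      unfolding filterlim_iff by auto
    moreover have "\<forall>\<^sub>F y in at_right z. y \<in> {z<..<x}"
      using z by (intro eventually_at_right_real)
    ultimately have "\<forall>\<^sub>F y in at_right z. (f ^^ Suc m) y \<in> {0<..<z} \<and> y \<in> {z<..<x}"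
      by eventually_elim auto
    then obtain y where y: "(f ^^ Suc m) y \<in> {0<..<z}" "y \<in> {z<..<x}"
      using eventually_happens'[OF trivial_limit_at_right_real] by blast
    have "\<exists>q\<in>{y..x}. (f ^^ Suc m) q = q"
    proof (rule funpow_fixed_point_between)
      show "(f ^^ i) t \<noteq> c" if "i < Suc m" "t \<in> {y..x}" for i t
        using nh'[of i t] that y by auto
      show "x \<le> (f ^^ Suc m) x" by (rule assms(5))
    qed (use y z assms(1,3) in auto)
    then show ?thesis using y by auto
  qed
  define j where "j = (LEAST j. ?P j)"
  have "?P j"
    unfolding j_def using P by (rule LeastI)
  then obtain q where q: "0 < j" "z < q" "q \<le> x" "(f ^^ j) q = q" by auto
  have j: "j \<le> Suc m"
    unfolding j_def using P by (rule Least_le)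
  have q01: "q \<in> {0..1}" using q z assms(1,3) by auto
  have period: "(f ^^ n) q = (f ^^ (n mod j)) q" for n
    using funpow_mod_eq[OF q(4)] by simp
  have ge: "q \<le> (f ^^ i) q" if "i < j" for i
  proof (rule ccontr)
    assume less: "\<not> q \<le> (f ^^ i) q"
    \<comment> \<open>The graph of \<open>f ^^ i\<close> is below the diagonal at \<open>q\<close>
      but not at \<open>x\<close>; a crossing would be fixed by \<open>f ^^ i\<close> with
      \<open>i < j\<close>.\<close>
    have "\<exists>p\<in>{q..x}. (f ^^ i) p = p"
    proof (rule funpow_fixed_point_between)
      show "(f ^^ k) t \<noteq> c" if "k < i" "t \<in> {q..x}" for k t
        using nh'[of k t] that q j \<open>i < j\<close> by auto
      show "x \<le> (f ^^ i) x" by (rule assms(5))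
    qed (use less q q01 assms(3) in auto)
    moreover have "0 < i" using less by (cases i) auto
    ultimately have "?P i" using q by auto
    then show False
      using not_less_Least[of i ?P] that unfolding j_def by blast
  qed
  have le: "(f ^^ i) q \<le> (f ^^ i) x" if "i < j" for i
  proof -
    have "strict_mono_on {z<..x} (f ^^ i)"
      using nh' that j z assms(1,3) by (intro funpow_continuous_strict_mono[THEN conjunct2]) auto
    then show ?thesis
      using q strict_mono_onD[of "{z<..x}" "f ^^ i" q x] by (cases "q = x") auto
  qed
  show ?thesis
  proof (intro exI conjI allI impI)
    show "l < q" using z q by simp
    show "q \<le> (f ^^ n) q" for n
      using ge[of "n mod j"] period[of n] q(1) by simp
    show "(f ^^ n) q \<noteq> c" for n
      using nh'[of "n mod j" q] period[of n] q j mod_less_divisor[OF q(1), of n] by simp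
  qed (use q le in auto)
qed

section \<open>Points of the bifurcation set\<close>

text \<open>If the orbit of \<open>f b\<close> exceeded the bound at time \<open>n\<close>, so would
  the orbits of all points slightly above \<open>f b\<close>. Then no survivor visits
  \<open>[f b, f e)\<close> for \<open>e\<close> slightly above \<open>b\<close>, and
  \<open>survivor_plus\<close> does not change from \<open>b\<close> to \<open>e\<close>.\<close>

lemma E_set_orbit_le:
  assumes E: "b \<in> E_set f c a" and "c < b"
  shows "(f ^^ n) (f b) \<le> (if a = c then 1 else f a)"
proof (rule ccontr)
  let ?A = "if a = c then 1 else f a"
  assume gt: "\<not> (f ^^ n) (f b) \<le> ?A"
  have adm: "admissible_right f c b"
    using E by (auto simp: E_set_def)
  have b: "0 \<le> b" "b < 1" "b \<noteq> c" "b \<in> {0..1}"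
    using assms(2) adm c_pos by (auto simp: admissible_right_def)
  have np: "(f ^^ i) (f b) \<noteq> c" for i
    using not_precritical_funpow(1)[OF b(4) admissible_right_not_precritical[OF adm assms(2)], of "Suc i"]
    by (simp add: funpow_swap1)
  have lim: "filterlim (f ^^ n) (at_right ((f ^^ n) (f b))) (at_right (f b))"
    using filterlim_funpow_at_right[of "f b" n] np f_in[OF b(4)] f_less_1[OF b(1-3)] by auto
  have "\<forall>\<^sub>F u in at_right ((f ^^ n) (f b)). ?A < u"
    using eventually_at_right_less by (rule eventually_mono) (use gt in simp)
  then have "\<forall>\<^sub>F y in at_right (f b). ?A < (f ^^ n) y"
    using lim unfolding filterlim_iff by blast
  then obtain d where d: "f b < d" "\<And>y. f b < y \<Longrightarrow> y < d \<Longrightarrow> ?A < (f ^^ n) y"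
    unfolding eventually_at_right_field by blast
  have "\<forall>\<^sub>F y in at_right b. f y < d"
    using filterlim_f_at_right[OF b(1-3)] eventually_at_right_real[OF d(1)]
    unfolding filterlim_iff by (auto elim: eventually_mono)
  moreover have "\<forall>\<^sub>F y in at_right b. y \<in> {b<..<1}"
    using b by (intro eventually_at_right_real)
  ultimately have "\<forall>\<^sub>F y in at_right b. f y < d \<and> y \<in> {b<..<1}"
    by eventually_elim auto
  then obtain e where e: "f e < d" "b < e" "e < 1"
    using eventually_happens'[OF trivial_limit_at_right_real] by force
  have be: "f b < f e"
    using e b assms(2) by (intro f_less) auto
  have "survivor_plus f c a e \<noteq> survivor_plus f c a b"
    using E e by (auto simp: E_set_def)
  moreover have "survivor_plus f c a e \<subseteq> survivor_plus f c a b"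
  proof
    fix y assume y: "y \<in> survivor_plus f c a e"
    have "f b \<le> (f ^^ i) y" for i
    proof -
      have "f e \<le> (f ^^ i) y"
        using y e assms(2) by (simp add: survivor_plus_def)
      then show ?thesis using be by simp
    qed
    then show "y \<in> survivor_plus f c a b"
      using y assms(2) by (simp add: survivor_plus_def)
  qed
  ultimately obtain y where y: "y \<in> survivor_plus f c a b" "y \<notin> survivor_plus f c a e"
    by blast
  then obtain k where k: "(f ^^ k) y < f e"
    using e assms(2) unfolding survivor_plus_def by (auto simp: not_le)
  have "f b \<le> (f ^^ k) y" "(f ^^ (n + k)) y \<le> ?A"
    using y(1) assms(2) by (simp_all add: survivor_plus_def)
  then show False
    using d(2)[of "(f ^^ k) y"] k e gt by (cases "f b = (f ^^ k) y") (auto simp: funpow_add)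
qed

text \<open>The last point \<open>y\<close> of the cycle of \<open>f b\<close> maps to
  \<open>f b\<close> and lies right of \<open>c\<close>, so it is \<open>b\<close>, which is thus
  periodic. The point \<open>f b\<close> survives for \<open>b\<close> but for no larger end point,
  which gives membership in \<open>E_set\<close>.\<close>

lemma periodic_mem_D_set:
  assumes b: "c < b" "b < 1" "f b < c"
    and j: "0 < j" "(f ^^ j) (f b) = f b"
    and ge: "\<And>n. f b \<le> (f ^^ n) (f b)"
    and le: "\<And>n. (f ^^ n) (f b) \<le> (if a = c then 1 else f a)"
    and np: "\<And>n. (f ^^ n) (f b) \<noteq> c"
  shows "b \<in> D_set f c a"
proof -
  have b01: "b \<in> {0..1}" using b c_pos by auto
  have fb: "f b \<in> {0..1}" by (rule f_in[OF b01])
  have pos: "0 < f b" using b by (intro f_pos) auto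
  obtain i where i: "j = Suc i" using j(1) by (cases j) auto
  define y where "y = (f ^^ i) (f b)"
  have fy: "f y = f b" using j(2) i by (simp add: y_def)
  have y01: "y \<in> {0..1}" unfolding y_def by (rule funpow_in[OF fb])
  \<comment> \<open>Otherwise \<open>f b \<le> y < c\<close> gives \<open>f (f b) \<le> f y = f b\<close>, a fixed point in \<open>(0, c)\<close>.\<close>
  have "\<not> y < c"
  proof
    assume "y < c"
    then have "f (f b) \<le> f b"
      using f_le[of "f b" y] fy fb y01 ge[of i] by (auto simp: y_def)
    then have "f (f b) = f b" using ge[of 1] by simp
    then show False using no_fixed_point_left[of "f b"] pos b by simp
  qed
  then have "c < y" using np[of i] by (simp add: y_def)
  then have y: "y = b"
    using f_less[of y b] f_less[of b y] fy b b01 y01 by (cases y b rule: linorder_cases) auto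
  have orbit: "(f ^^ n) b = (f ^^ (n + i)) (f b)" for n
  proof -
    have "(f ^^ (n + i)) (f b) = (f ^^ n) y"
      by (simp only: y_def funpow_add comp_apply)
    then show ?thesis by (simp only: y)
  qed
  have npb: "b \<notin> precritical f c"
    using orbit np by (auto simp: precritical_def)
  have kb: "kneading_right f c b = itinerary f c b"
    using kneading_right_eq_itinerary npb b b01 by auto
  have "(f ^^ j) b = y"
    by (simp only: i y_def funpow_Suc_right comp_apply)
  then have period: "(f ^^ j) b = b"
    by (simp only: y)
  have "itinerary f c b n = map (itinerary f c b) [0..<j] ! (n mod length (map (itinerary f c b) [0..<j]))" for n
    using funpow_mod_eq[OF period, of n] j(1) by (simp add: itinerary_def)
  then have per: "periodic_seq (kneading_right f c b)"
    unfolding periodic_seq_def kb using j(1)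
    by (intro exI[of _ "map (itinerary f c b) [0..<j]"]) auto
  have sh: "(shift ^^ n) (itinerary f c b) = itinerary f c ((f ^^ n) b)" for n
    by (simp add: shift_funpow itinerary_funpow fun_eq_iff)
  \<comment> \<open>The orbit of \<open>b\<close> stays in the orbit of \<open>f b\<close>, whose
    least point is \<open>f b\<close>; monotonicity of itineraries turns this into the lexicographic
    bound.\<close>
  have "lex_le (shift (itinerary f c b)) ((shift ^^ n) (itinerary f c b))" for n
    using itinerary_mono[OF fb _ funpow_in[OF b01, of n]] not_precritical_funpow(2)[OF b01 npb, of n]
      not_precritical_funpow(2)[OF b01 npb, of 1] ge[of "n + i"] orbit[of n] sh[of 1] sh[of n]
    by simp
  then have adm: "admissible_right f c b"
    unfolding admissible_right_def self_admissible_def kb using b by (auto simp: itinerary_def)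
  have surv: "f b \<in> survivor_plus f c a b"
    using ge le fb b by (auto simp: survivor_plus_def)
  have "f b \<notin> survivor_plus f c a e" if "e \<in> {b<..1}" for e
  proof
    assume "f b \<in> survivor_plus f c a e"
    then have "f e \<le> (f ^^ 0) (f b)"
      using that b unfolding survivor_plus_def by (auto dest: spec[of _ 0])
    moreover have "f b < f e"
      using that b b01 by (intro f_less) auto
    ultimately show False by simp
  qed
  then have "survivor_plus f c a e \<noteq> survivor_plus f c a b" if "e \<in> {b<..1}" for e
    using surv that by metis
  then have "b \<in> E_set f c a"
    using adm surv b unfolding E_set_def by auto
  then show ?thesis
    using per by (simp add: D_set_def)
qed

lemma E_set_in_closure_D_set:
  assumes E: "b \<in> E_set f c a" and "c < b"
  shows "b \<in> closure (D_set f c a)"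
  unfolding closure_approachable
proof (intro allI impI)
  fix e :: real assume "0 < e"
  have adm: "admissible_right f c b"
    using E by (auto simp: E_set_def)
  have b: "b < 1" "b \<in> {0..1}"
    using assms(2) adm c_pos by (auto simp: admissible_right_def)
  have npb: "b \<notin> precritical f c"
    by (rule admissible_right_not_precritical[OF adm assms(2)])
  have "kneading_right f c b 1 = 0"
    using adm by (simp add: admissible_right_def)
  then have fb: "f b < c"
    using kneading_right_eq_itinerary[of b] npb b by (simp add: itinerary_def split: if_splits)
  \<comment> \<open>Right of \<open>c\<close> and within \<open>e\<close> of \<open>b\<close>, so
    that a point between \<open>f b0\<close> and \<open>f b\<close> pulls back along the right
    branch to within \<open>e\<close> of \<open>b\<close>.\<close>
  define b0 where "b0 = max ((c + b) / 2) (b - e / 2)"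
  have b0: "c < b0" "b0 < b" "b - e < b0"
    using \<open>0 < e\<close> assms(2) by (auto simp: b0_def less_max_iff_disj)
  have fb0: "0 \<le> f b0" "f b0 < f b"
    using f_in[of b0] f_less[of b0 b] b0 b c_pos by auto
  have "f b \<le> 1" using f_in[OF b(2)] by simp
  moreover have "f b \<notin> precritical f c"
    using not_precritical_funpow(2)[OF b(2) npb, of 1] by simp
  moreover have "f b \<le> (f ^^ n) (f b)" for n
    using admissible_right_orbit_ge[OF adm assms(2), of "Suc n"] by (simp add: funpow_swap1)
  ultimately obtain q j where q: "f b0 < q" "q \<le> f b" "0 < j" "(f ^^ j) q = q" "\<And>n. q \<le> (f ^^ n) q"
    "\<And>i. i < j \<Longrightarrow> (f ^^ i) q \<le> (f ^^ i) (f b)" "\<And>n. (f ^^ n) q \<noteq> c"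
    using exists_minimal_periodic_point[OF fb0] by blast
  have "continuous_on {b0..b} f"
    using b0 b by (intro continuous_on_subset[OF cont_right]) auto
  then obtain b' where b': "b0 \<le> b'" "b' \<le> b" "f b' = q"
    using IVT'[of f b0 q b] q b0 by auto
  \<comment> \<open>Orbits are compared over one period only, so \<open>n\<close> is reduced modulo
    \<open>j\<close> first.\<close>
  have "(f ^^ n) q \<le> (if a = c then 1 else f a)" for n
    using funpow_mod_eq[OF q(4), of n] q(6)[of "n mod j"] q(3) E_set_orbit_le[OF assms, of "n mod j"]
    by (metis mod_less_divisor order_trans)
  then have "b' \<in> D_set f c a"
    using b' b0 b q fb by (intro periodic_mem_D_set[of _ j]) auto
  then show "\<exists>y\<in>D_set f c a. dist y b < e"
    using b' b0 by (intro bexI[of _ b']) (auto simp: dist_real_def)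
qed

end

text \<open>The construction yields points of \<open>(c, b]\<close>, which is empty for
  \<open>b = c\<close>. The end point \<open>c\<close> is covered when it belongs to
  \<open>D_set\<close> or is a limit of other points of \<open>E_set\<close>, which already lie in
  the closure.\<close>

theorem theorem1p2:
  fixes f :: "real \<Rightarrow> real" and c a :: real
  assumes "lorenz_map f c"
    and "expansive f c"
    and "a \<in> {0..c}"
    and "admissible_left f c a"
  shows "E_set f c a - {c} \<subseteq> closure (D_set f c a) \<and>
         ((c \<in> E_set f c a \<longrightarrow> c \<in> D_set f c a \<or> c islimpt E_set f c a) \<longrightarrow>
           E_set f c a \<subseteq> closure (D_set f c a))"
proof -
  interpret lorenz f c
    using assms by unfold_locales
  have sub: "E_set f c a - {c} \<subseteq> closure (D_set f c a)"
    using E_set_in_closure_D_set by (force simp: E_set_def)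
  have "c \<in> closure (D_set f c a)" if "c islimpt E_set f c a"
  proof -
    have "c islimpt closure (D_set f c a)"
      using that sub unfolding islimpt_def by blast
    then show ?thesis
      using closed_limpt by blast
  qed
  then show ?thesis
    using sub closure_subset[of "D_set f c a"] by blast
qed

end
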